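(* Let $a,b,c\in\mathbb{C}$ be noncollinear and $f(z)=(z-a)(z-b)(z-c)$. Write $\mathtt{B}_\triangle=B_1+iB_2$ with $B_1,B_2\in\mathbb{R}$. The Gaussian curvature $K$ of the graph of $f$, regarded as a function on $\mathbb{R}^2\cong\mathbb{C}$, has a critical point at $\mathtt{b}_\triangle$. Its other critical points are described as follows. (1) If $B_1=B_2=0$, the other critical points form the circle centered at the barycenter $\mathtt{b}_\triangle$ with radius $\frac{1}{\sqrt[4]{45}}$. (2) If $B_1\neq0$ and $B_2=0$, there are four other critical points, symmetric in pairs with respect to the barycenter: $\mathtt{b}_\triangle+\widetilde X_1,\ \mathtt{b}_\triangle-\widetilde X_1$ and $\mathtt{b}_\triangle+\widetilde Y_1,\ \mathtt{b}_\triangle-\widetilde Y_1$, where $$\widetilde X_1=\left(\tfrac{1}{\sqrt{15}}\sqrt{\sqrt{81B_1^2+5}+6B_1},\,0\right),\qquad \widetilde Y_1=\left(0,\,\tfrac{1}{\sqrt{15}}\sqrt{\sqrt{81B_1^2+5}-6B_1}\right).$$ (3) If $B_2\neq0$, there are four other critical points, symmetric in pairs with respect to the barycenter: $\mathtt{b}_\triangle+\widetilde Z_1,\ \mathtt{b}_\triangle-\widetilde Z_1$ and $\mathtt{b}_\triangle+\widetilde W_1,\ \mathtt{b}_\triangle-\widetilde W_1$, where $$\widetilde Z_1=\left(\tfrac{B_2}{\sqrt{30}}x_0,\ \tfrac{-B_1+|\mathtt{B}_\triangle|}{\sqrt{30}}x_0\right),\qquad x_0=\frac{\sqrt{\sqrt{81|\mathtt{B}_\triangle|^2+5}+6|\mathtt{B}_\triangle|}}{\sqrt{|\mathtt{B}_\triangle|^2-B_1|\mathtt{B}_\triangle|}},$$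 $$\widetilde W_1=\left(\tfrac{B_2}{\sqrt{30}}x_0',\ \tfrac{-B_1-|\mathtt{B}_\triangle|}{\sqrt{30}}x_0'\right),\qquad x_0'=\frac{\sqrt{\sqrt{81|\mathtt{B}_\triangle|^2+5}-6|\mathtt{B}_\triangle|}}{\sqrt{|\mathtt{B}_\triangle|^2+B_1|\mathtt{B}_\triangle|}}.$$
   Context: Notation: $\mathtt{b}_\triangle=\frac{a+b+c}{3}$ is the barycenter of the triangle with vertices $a,b,c$, and $\mathtt{B}_\triangle=\mathtt{b}_\triangle^2-\frac{ab+ac+bc}{3}$. Points of $\mathbb{R}^2$ are identified with complex numbers via $(x,y)\leftrightarrow x+iy$. The graph $\Gamma(f)=\{(z,f(z)):z\in\mathbb{C}\}\subset\mathbb{C}^2\cong\mathbb{R}^4$ carries the metric induced from $\mathbb{R}^4$; its Gaussian curvature at $(z,f(z))$ is $$K(z)=-\frac{8}{81}\,\frac{|z-\mathtt{b}_\triangle|^2}{\left[\frac19+\left|(z-\mathtt{b}_\triangle)^2-\mathtt{B}_\triangle\right|^2\right]^3}.$$ Critical points are points where $K_x=K_y=0$. *)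

theory Defs
  imports "HOL-Analysis.Analysis"
begin

definition barycenter :: "complex \<Rightarrow> complex \<Rightarrow> complex \<Rightarrow> complex" where
  "barycenter a b c = (a + b + c) / 3"

definition B_triangle :: "complex \<Rightarrow> complex \<Rightarrow> complex \<Rightarrow> complex" where
  "B_triangle a b c = (barycenter a b c)\<^sup>2 - (a * b + a * c + b * c) / 3"

definition partial_x :: "(complex \<Rightarrow> 'a::real_normed_vector) \<Rightarrow> complex \<Rightarrow> 'a" where
  "partial_x h z = vector_derivative (\<lambda>t. h (z + of_real t)) (at 0)"

definition partial_y :: "(complex \<Rightarrow> 'a::real_normed_vector) \<Rightarrow> complex \<Rightarrow> 'a" where
  "partial_y h z = vector_derivative (\<lambda>t. h (z + \<i> * of_real t)) (at 0)"

text \<open>Gaussian curvature of the parametrized surface \<open>X\<close>, at the parameter \<open>z\<close>, for the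
  metric \<open>E dx\<^sup>2 + 2 F dx dy + G dy\<^sup>2\<close> induced from the ambient inner product: Brioschi's
  formula. It is intrinsic, hence meaningful in any codimension; it is only to be used for
  immersions \<open>X\<close> whose partial derivatives up to order three exist.\<close>

definition gaussian_curvature :: "(complex \<Rightarrow> 'a::real_inner) \<Rightarrow> complex \<Rightarrow> real" where
  "gaussian_curvature X z =
    (let E = (\<lambda>w. partial_x X w \<bullet> partial_x X w);
         F = (\<lambda>w. partial_x X w \<bullet> partial_y X w);
         G = (\<lambda>w. partial_y X w \<bullet> partial_y X w)
     in (det (vector
           [vector [- partial_y (partial_y E) z / 2 + partial_y (partial_x F) z
                      - partial_x (partial_x G) z / 2,
                    partial_x E z / 2, partial_x F z - partial_y E z / 2],
            vector [partial_y F z - partial_x G z / 2, E z, F z],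
            vector [partial_y G z / 2, F z, G z]] :: real^3^3)
       - det (vector
           [vector [0, partial_y E z / 2, partial_x G z / 2],
            vector [partial_y E z / 2, E z, F z],
            vector [partial_x G z / 2, F z, G z]] :: real^3^3))
       / (E z * G z - (F z)\<^sup>2)\<^sup>2)"

text \<open>\<open>K\<^sub>x = K\<^sub>y = 0\<close> at \<open>z\<close>; existence of the two partial derivatives is part of the
  condition.\<close>

definition critical_point :: "(complex \<Rightarrow> real) \<Rightarrow> complex \<Rightarrow> bool" where
  "critical_point K z \<longleftrightarrow>
    ((\<lambda>t. K (z + of_real t)) has_real_derivative 0) (at 0) \<and>
    ((\<lambda>t. K (z + \<i> * of_real t)) has_real_derivative 0) (at 0)"

lemma partial_x_eqI: "((\<lambda>t. h (z + of_real t)) has_vector_derivative d) (at 0) \<Longrightarrow> partial_x h z = d"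
  unfolding partial_x_def by (rule vector_derivative_at)

lemma partial_y_eqI: "((\<lambda>t. h (z + \<i> * of_real t)) has_vector_derivative d) (at 0) \<Longrightarrow> partial_y h z = d"
  unfolding partial_y_def by (rule vector_derivative_at)

lemma has_vector_derivative_x:
  assumes "(f has_field_derivative d) (at z)"
  shows "((\<lambda>t. f (z + of_real t)) has_vector_derivative d) (at 0)"
proof -
  have "((\<lambda>t. z + of_real t) has_vector_derivative 1) (at (0::real))"
    by (auto intro!: derivative_eq_intros)
  from field_vector_diff_chain_at[OF this, of f d] assms show ?thesis by (simp add: o_def)
qed

lemma has_vector_derivative_y:
  assumes "(f has_field_derivative d) (at z)"
  shows "((\<lambda>t. f (z + \<i> * of_real t)) has_vector_derivative (\<i> * d)) (at 0)"
proof -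
  have "((\<lambda>t. z + \<i> * of_real t) has_vector_derivative \<i>) (at (0::real))"
    by (auto intro!: derivative_eq_intros)
  from field_vector_diff_chain_at[OF this, of f d] assms show ?thesis by (simp add: o_def)
qed

lemma partial_x_inner:
  assumes "(f has_field_derivative d) (at z)" "(g has_field_derivative e) (at z)"
  shows "partial_x (\<lambda>z. k + (f z \<bullet> g z)) z = f z \<bullet> e + d \<bullet> g z"
  apply (rule partial_x_eqI)
  using bounded_bilinear.has_vector_derivative[OF bounded_bilinear_inner
      has_vector_derivative_x[OF assms(1)] has_vector_derivative_x[OF assms(2)]]
  by (auto intro!: derivative_eq_intros)

lemma partial_y_inner:
  assumes "(f has_field_derivative d) (at z)" "(g has_field_derivative e) (at z)"
  shows "partial_y (\<lambda>z. k + (f z \<bullet> g z)) z = f z \<bullet> (\<i>*e) + (\<i>*d) \<bullet> g z"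
  apply (rule partial_y_eqI)
  using bounded_bilinear.has_vector_derivative[OF bounded_bilinear_inner
      has_vector_derivative_y[OF assms(1)] has_vector_derivative_y[OF assms(2)]]
  by (auto intro!: derivative_eq_intros)

lemma gaussian_curvature_holomorphic_graph:
  assumes f: "\<And>z. (f has_field_derivative f1 z) (at z)"
    "\<And>z. (f1 has_field_derivative f2 z) (at z)"
    "\<And>z. (f2 has_field_derivative f3 z) (at z)"
  shows "gaussian_curvature (\<lambda>z. (z, f z)) z =
    - 2 * (cmod (f2 z))\<^sup>2 / (1 + (cmod (f1 z))\<^sup>2)^3"
proof -
  have X: "partial_x (\<lambda>z. (z, f z)) = (\<lambda>z. (1, f1 z))"
    apply (rule ext, rule partial_x_eqI) apply (rule has_vector_derivative_Pair)
    by (auto intro!: derivative_eq_intros has_vector_derivative_x f)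
  have Y: "partial_y (\<lambda>z. (z, f z)) = (\<lambda>z. (\<i>, \<i> * f1 z))"
    apply (rule ext, rule partial_y_eqI) apply (rule has_vector_derivative_Pair)
    by (auto intro!: derivative_eq_intros has_vector_derivative_y f)
  let ?E = "\<lambda>z. 1 + (f1 z \<bullet> f1 z)"
  have i: "f1 w \<bullet> (\<i> * f1 w) = 0" "(\<i> * f1 w) \<bullet> (\<i> * f1 w) = f1 w \<bullet> f1 w" for w
    by (auto simp: inner_complex_def algebra_simps)
  have Ex: "partial_x ?E = (\<lambda>z. 0 + (2 * f1 z) \<bullet> f2 z)"
    apply (rule ext, subst partial_x_inner[OF f(2) f(2)])
    by (simp add: inner_commute inner_complex_def)
  have Ey: "partial_y ?E = (\<lambda>z. 0 + (2 * f1 z) \<bullet> (\<i> * f2 z))"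
    apply (rule ext, subst partial_y_inner[OF f(2) f(2)])
    by (simp add: inner_commute inner_complex_def algebra_simps)
  have Exx: "partial_x (partial_x ?E) z = (2 * f1 z) \<bullet> f3 z + (2*f2 z) \<bullet> f2 z"
    unfolding Ex by (rule partial_x_inner) (auto intro!: derivative_eq_intros f)
  have Eyy: "partial_y (partial_y ?E) z = (2 * f1 z) \<bullet> (\<i> * (\<i> * f3 z)) + (\<i>*(2*f2 z)) \<bullet> (\<i>*f2 z)"
    unfolding Ey by (rule partial_y_inner) (auto intro!: derivative_eq_intros f)
  have c: "partial_x (\<lambda>z. 0::real) = (\<lambda>z. 0)" "partial_y (\<lambda>z. 0::real) = (\<lambda>z. 0)"
    unfolding partial_x_def partial_y_def by auto
  have E0: "?E z > 0" by (smt (verit) inner_ge_zero)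
  have E1: "1 + (cmod (f1 z))\<^sup>2 = ?E z" by (simp add: power2_norm_eq_inner)
  show ?thesis
    unfolding gaussian_curvature_def Let_def X Y inner_prod_def fst_conv snd_conv i
    apply (simp add: i c inner_complex_def[of 1] inner_complex_def[of \<i>])
    apply (simp only: Exx Eyy det_3 vector_3 E1)
    using E0 apply (simp add: Ex Ey divide_simps)
    apply (simp add: cmod_power2 inner_complex_def)
    by algebra
qed

lemma gaussian_curvature_cubic_graph:
  "gaussian_curvature (\<lambda>z. (z, (z - a) * (z - b) * (z - c))) z =
     - (8 / 81) * (cmod (z - barycenter a b c))\<^sup>2
       / (1 / 9 + (cmod ((z - barycenter a b c)\<^sup>2 - B_triangle a b c))\<^sup>2) ^ 3"
proof -
  let ?w = "\<lambda>z. z - barycenter a b c"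
  let ?q = "\<lambda>z. (?w z)\<^sup>2 - B_triangle a b c"
  have 1: "((\<lambda>z. (z - a) * (z - b) * (z - c)) has_field_derivative 3 * ?q z) (at z)" for z
    by (auto intro!: derivative_eq_intros
        simp: barycenter_def B_triangle_def field_simps power2_eq_square)
  have 2: "((\<lambda>z. 3 * ?q z) has_field_derivative 6 * ?w z) (at z)" for z
    by (auto intro!: derivative_eq_intros)
  have 3: "((\<lambda>z. 6 * ?w z) has_field_derivative 6) (at z)" for z
    by (auto intro!: derivative_eq_intros)
  have "gaussian_curvature (\<lambda>z. (z, (z - a) * (z - b) * (z - c))) z =
      - 2 * (6 * cmod (?w z))\<^sup>2 / (1 + (3 * cmod (?q z))\<^sup>2) ^ 3"
    by (simp only: gaussian_curvature_holomorphic_graph[OF 1 2 3] norm_mult norm_numeral)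
  also have "1 + (3 * cmod (?q z))\<^sup>2 = 9 * (1 / 9 + (cmod (?q z))\<^sup>2)"
    by (simp add: power_mult_distrib)
  finally show ?thesis
    by (simp only: power_mult_distrib) simp
qed

end

theory Submission
  imports Defs
begin

text \<open>
  Put \<open>w = z - b\<close> with \<open>b\<close> the barycenter, \<open>q = w\<^sup>2 - B\<close> and \<open>D = 1/9 + \<bar>q\<bar>\<^sup>2\<close>, so that the
  curvature is \<open>-(8/81) \<bar>w\<bar>\<^sup>2 / D\<^sup>3\<close>. Since \<open>w\<close> and \<open>q\<close> are holomorphic, the gradient of this
  function, read as a complex number, is a nonzero multiple of
  \<open>w D - 6 \<bar>w\<bar>\<^sup>2 q cnj w\<close> (\<open>critical_point_cubic_curvature\<close>). It vanishes at \<open>w = 0\<close>; for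
  \<open>w \<noteq> 0\<close> it vanishes exactly when \<open>D = 6 (cnj w)\<^sup>2 (w\<^sup>2 - B)\<close>.

  The left side is real, hence so is \<open>B (cnj w)\<^sup>2\<close>. If \<open>B = 0\<close>, only the modulus of \<open>w\<close> is
  constrained, by \<open>45 \<bar>w\<bar>\<^sup>4 = 1\<close>, and the solutions form a circle. If \<open>B \<noteq> 0\<close>, then
  \<open>w\<^sup>2 = r B\<close> for a real \<open>r\<close>, and what remains is a quadratic equation for \<open>r\<close> with two
  roots of opposite signs (\<open>reduced_critical_equation_iff_square\<close>). The four other critical
  points are thus the square roots of two different nonzero complex numbers, and the theorem
  only has to recognise the given vectors as such square roots.
\<close>

section \<open>The critical point equation\<close>

text \<open>Both partial derivatives are instances \<open>v = 1\<close> and \<open>v = \<i>\<close> of a directional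
  derivative. The adjoint rule \<open>q \<bullet> (w v) = (q cnj w) \<bullet> v\<close> collects it into the inner product
  of \<open>v\<close> with a gradient vector.\<close>

lemma cubic_curvature_directional_derivative:
  fixes z v p B :: complex
  defines "w \<equiv> z - p"
  defines "D \<equiv> 1 / 9 + (cmod (w\<^sup>2 - B))\<^sup>2"
  shows "((\<lambda>t. - (8 / 81) * (cmod (z + v * of_real t - p))\<^sup>2
            / (1 / 9 + (cmod ((z + v * of_real t - p)\<^sup>2 - B))\<^sup>2) ^ 3)
          has_real_derivative
          - (16 / 81) / D ^ 4
            * ((w * of_real D - 6 * of_real ((cmod w)\<^sup>2) * (w\<^sup>2 - B) * cnj w) \<bullet> v)) (at 0)"
proof -
  have sq: "((\<lambda>t. (cmod (f t))\<^sup>2) has_real_derivative 2 * (f 0 \<bullet> f')) (at 0)"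
    if "(f has_vector_derivative f') (at 0)" for f :: "real \<Rightarrow> complex" and f'
    using bounded_bilinear.has_vector_derivative[OF bounded_bilinear_inner that that]
    by (simp add: power2_norm_eq_inner has_real_derivative_iff_has_vector_derivative
        inner_commute)
  have dw: "((\<lambda>t. z + v * of_real t - p) has_vector_derivative v) (at 0)"
    by (auto intro!: derivative_eq_intros)
  have dq: "((\<lambda>t. (z + v * of_real t - p)\<^sup>2 - B) has_vector_derivative 2 * w * v) (at 0)"
    unfolding power2_eq_square w_def by (auto intro!: derivative_eq_intros)
  have dN: "((\<lambda>t. (cmod (z + v * of_real t - p))\<^sup>2) has_real_derivative 2 * (w \<bullet> v)) (at 0)"
    using sq[OF dw] by (simp add: w_def)
  have dD: "((\<lambda>t. (cmod ((z + v * of_real t - p)\<^sup>2 - B))\<^sup>2)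
      has_real_derivative 2 * ((w\<^sup>2 - B) \<bullet> (2 * w * v))) (at 0)"
    using sq[OF dq] by (simp add: w_def)
  have D0: "D \<noteq> 0"
    unfolding D_def by (smt (verit) zero_le_power2 divide_pos_pos)
  have adj: "(w\<^sup>2 - B) \<bullet> (2 * w * v) = 2 * (((w\<^sup>2 - B) * cnj w) \<bullet> v)"
    by (simp add: inner_complex_def algebra_simps)
  have grad: "(w * of_real D - 6 * of_real u * (w\<^sup>2 - B) * cnj w) \<bullet> v
      = D * (w \<bullet> v) - 6 * u * (((w\<^sup>2 - B) * cnj w) \<bullet> v)" for u :: real
    by (simp add: inner_complex_def algebra_simps)
  have quot: "((\<lambda>t. - (8 / 81) * N t / (1 / 9 + Q t) ^ 3) has_real_derivative
      - (8 / 81) * (N' * (1 / 9 + Q 0) - 3 * N 0 * Q') / (1 / 9 + Q 0) ^ 4) (at 0)"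
    if "(N has_real_derivative N') (at 0)" "(Q has_real_derivative Q') (at 0)"
      "1 / 9 + Q 0 \<noteq> 0" for N Q :: "real \<Rightarrow> real" and N' Q'
  proof -
    have alg: "((- (8 / 81) * N') * E ^ 3 - (- (8 / 81) * M) * (3 * E\<^sup>2 * Q')) / (E ^ 3 * E ^ 3)
        = - (8 / 81) * (N' * E - 3 * M * Q') / E ^ 4" if "E \<noteq> 0" for E M :: real
      using that by (simp add: divide_simps) algebra
    have "((\<lambda>t. (1 / 9 + Q t) ^ 3) has_real_derivative 3 * (1 / 9 + Q 0)\<^sup>2 * Q') (at 0)"
      using that by (auto intro!: derivative_eq_intros)
    from DERIV_divide[OF DERIV_cmult[OF that(1), of "- (8 / 81)"] this] that(3)
    have "((\<lambda>t. - (8 / 81) * N t / (1 / 9 + Q t) ^ 3) has_real_derivative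
        ((- (8 / 81) * N') * (1 / 9 + Q 0) ^ 3
          - (- (8 / 81) * N 0) * (3 * (1 / 9 + Q 0)\<^sup>2 * Q'))
        / ((1 / 9 + Q 0) ^ 3 * (1 / 9 + Q 0) ^ 3)) (at 0)"
      by simp
    then show ?thesis
      unfolding alg[OF that(3)] .
  qed
  have "- (8 / 81) * (2 * (w \<bullet> v) * D - 3 * (cmod w)\<^sup>2 * (2 * ((w\<^sup>2 - B) \<bullet> (2 * w * v)))) / D ^ 4
      = - (16 / 81) / D ^ 4
        * ((w * of_real D - 6 * of_real ((cmod w)\<^sup>2) * (w\<^sup>2 - B) * cnj w) \<bullet> v)"
    unfolding adj grad using D0 by (simp add: divide_simps)
  with quot[OF dN dD] D0 show ?thesis
    by (simp add: D_def w_def)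
qed

lemma critical_point_cubic_curvature:
  fixes a b c z :: complex
  defines "w \<equiv> z - barycenter a b c" and "B \<equiv> B_triangle a b c"
  shows "critical_point (gaussian_curvature (\<lambda>z. (z, (z - a) * (z - b) * (z - c)))) z \<longleftrightarrow>
    w * of_real (1 / 9 + (cmod (w\<^sup>2 - B))\<^sup>2) = 6 * of_real ((cmod w)\<^sup>2) * (w\<^sup>2 - B) * cnj w"
proof -
  let ?K = "gaussian_curvature (\<lambda>z. (z, (z - a) * (z - b) * (z - c)))"
  let ?D = "1 / 9 + (cmod (w\<^sup>2 - B))\<^sup>2"
  define g where
    "g = w * of_real ?D - 6 * of_real ((cmod w)\<^sup>2) * (w\<^sup>2 - B) * cnj w"
  have D0: "?D \<noteq> 0"
    by (smt (verit) zero_le_power2 divide_pos_pos)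
  have d: "((\<lambda>t. ?K (z + v * of_real t)) has_real_derivative - (16 / 81) / ?D ^ 4 * (g \<bullet> v)) (at 0)"
    for v
    unfolding gaussian_curvature_cubic_graph g_def w_def B_def
    by (rule cubic_curvature_directional_derivative)
  have "((\<lambda>t. ?K (z + v * of_real t)) has_real_derivative 0) (at 0) \<longleftrightarrow> g \<bullet> v = 0" for v
  proof
    assume "((\<lambda>t. ?K (z + v * of_real t)) has_real_derivative 0) (at 0)"
    then have "- (16 / 81) / ?D ^ 4 * (g \<bullet> v) = 0"
      by (rule DERIV_unique[OF d])
    with D0 show "g \<bullet> v = 0"
      by (simp only: mult_eq_0_iff divide_eq_0_iff power_eq_0_iff) simp
  next
    assume "g \<bullet> v = 0"
    with d[of v] show "((\<lambda>t. ?K (z + v * of_real t)) has_real_derivative 0) (at 0)"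
      by simp
  qed
  from this[of 1] this[of \<i>] have "critical_point ?K z \<longleftrightarrow> g = 0"
    by (simp add: critical_point_def inner_complex_def complex_eq_iff)
  then show ?thesis
    by (simp add: g_def)
qed

text \<open>Since \<open>\<bar>w\<bar>\<^sup>2 = w cnj w\<close>, a factor \<open>w\<close> cancels from the critical point equation, and
  what remains has a real left side.\<close>

lemma critical_point_cubic_curvature_reduced:
  fixes a b c z :: complex
  defines "w \<equiv> z - barycenter a b c" and "B \<equiv> B_triangle a b c"
  assumes "w \<noteq> 0"
  shows "critical_point (gaussian_curvature (\<lambda>z. (z, (z - a) * (z - b) * (z - c)))) z \<longleftrightarrow>
    of_real (1 / 9 + (cmod (w\<^sup>2 - B))\<^sup>2) = 6 * (cnj w)\<^sup>2 * (w\<^sup>2 - B)"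
proof -
  have "w * of_real d = 6 * of_real ((cmod w)\<^sup>2) * q * cnj w \<longleftrightarrow> of_real d = 6 * (cnj w)\<^sup>2 * q"
    for d q
  proof -
    have "6 * of_real ((cmod w)\<^sup>2) * q * cnj w = w * (6 * (cnj w)\<^sup>2 * q)"
      unfolding complex_norm_square by (simp add: power2_eq_square)
    then show ?thesis
      by (simp only: mult_cancel_left \<open>w \<noteq> 0\<close> simp_thms)
  qed
  then show ?thesis
    unfolding w_def B_def critical_point_cubic_curvature by blast
qed

section \<open>Solving the equation\<close>

text \<open>For \<open>B = 0\<close> both sides depend on \<open>\<bar>w\<bar>\<close> alone.\<close>

lemma reduced_critical_equation_iff_norm:
  fixes w :: complex
  shows "of_real (1 / 9 + (cmod (w\<^sup>2))\<^sup>2) = 6 * (cnj w)\<^sup>2 * w\<^sup>2 \<longleftrightarrow> cmod w = 1 / root 4 45"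
proof -
  have "6 * (cnj w)\<^sup>2 * w\<^sup>2 = of_real (6 * cmod w ^ 4)"
  proof -
    have "6 * (cnj w)\<^sup>2 * w\<^sup>2 = 6 * (w * cnj w)\<^sup>2"
      by (simp add: power_mult_distrib)
    also have "\<dots> = of_real (6 * ((cmod w)\<^sup>2)\<^sup>2)"
      by (simp only: complex_norm_square[symmetric]) simp
    finally show ?thesis
      by simp
  qed
  moreover have "(cmod (w\<^sup>2))\<^sup>2 = cmod w ^ 4"
    by (simp add: norm_power)
  ultimately have "of_real (1 / 9 + (cmod (w\<^sup>2))\<^sup>2) = 6 * (cnj w)\<^sup>2 * w\<^sup>2
      \<longleftrightarrow> 1 / 9 + cmod w ^ 4 = 6 * cmod w ^ 4"
    by (simp only: of_real_eq_iff)
  also have "\<dots> \<longleftrightarrow> cmod w ^ 4 = (1 / root 4 45) ^ 4"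
    by (simp add: power_divide) linarith
  also have "\<dots> \<longleftrightarrow> cmod w = 1 / root 4 45"
    by (rule power_eq_iff_eq_base) auto
  finally show ?thesis .
qed

text \<open>For \<open>B \<noteq> 0\<close> the equation says that \<open>B (cnj w)\<^sup>2\<close> is a real number \<open>p\<close> with
  \<open>5 \<bar>w\<bar>\<^sup>4 = 4 p + \<bar>B\<bar>\<^sup>2 + 1/9\<close>. Writing \<open>w\<^sup>2 = r B\<close> with real \<open>r\<close>, this becomes
  \<open>5 \<bar>B\<bar>\<^sup>2 r\<^sup>2 - 4 \<bar>B\<bar>\<^sup>2 r - \<bar>B\<bar>\<^sup>2 - 1/9 = 0\<close>, and \<open>\<surd>(81 \<bar>B\<bar>\<^sup>2 + 5)\<close> comes from its
  discriminant.\<close>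

lemma reduced_critical_equation_iff_square:
  fixes w B :: complex
  assumes "B \<noteq> 0"
  defines "s \<equiv> sqrt (81 * (cmod B)\<^sup>2 + 5)"
  shows "of_real (1 / 9 + (cmod (w\<^sup>2 - B))\<^sup>2) = 6 * (cnj w)\<^sup>2 * (w\<^sup>2 - B) \<longleftrightarrow>
    w\<^sup>2 = of_real ((6 * cmod B + s) / (15 * cmod B)) * B \<or>
    w\<^sup>2 = of_real ((6 * cmod B - s) / (15 * cmod B)) * B"
proof -
  define n where "n = cmod B"
  have n: "n > 0"
    using assms by (simp add: n_def)
  have s2: "s\<^sup>2 = 81 * n\<^sup>2 + 5"
    by (simp add: s_def n_def)
  have BB: "B * cnj B = of_real (n\<^sup>2)"
    by (simp only: n_def complex_norm_square)
  have real_multiple: "of_real (1 / 9 + (cmod (v - B))\<^sup>2) = 6 * cnj v * (v - B) \<longleftrightarrow>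
      45 * n\<^sup>2 * r\<^sup>2 - 36 * n\<^sup>2 * r - 9 * n\<^sup>2 - 1 = 0" if "v = of_real r * B" for v r
  proof -
    have "v - B = of_real (r - 1) * B"
      by (simp add: that algebra_simps)
    then have "(cmod (v - B))\<^sup>2 = (r - 1)\<^sup>2 * n\<^sup>2"
      by (simp only: norm_mult norm_of_real power_mult_distrib n_def power2_abs)
    moreover have "6 * cnj v * (v - B) = of_real (6 * r * (r - 1) * n\<^sup>2)"
    proof -
      have "6 * cnj v * (v - B) = of_real (6 * r * (r - 1)) * (B * cnj B)"
        by (simp add: that algebra_simps)
      then show ?thesis
        by (simp add: BB)
    qed
    ultimately have "of_real (1 / 9 + (cmod (v - B))\<^sup>2) = 6 * cnj v * (v - B)
        \<longleftrightarrow> 1 / 9 + (r - 1)\<^sup>2 * n\<^sup>2 = 6 * r * (r - 1) * n\<^sup>2"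
      by (simp only: of_real_eq_iff)
    then show ?thesis
      by (simp add: power2_eq_square algebra_simps) linarith
  qed
  have roots: "45 * n\<^sup>2 * r\<^sup>2 - 36 * n\<^sup>2 * r - 9 * n\<^sup>2 - 1 = 0 \<longleftrightarrow>
      r = (6 * n + s) / (15 * n) \<or> r = (6 * n - s) / (15 * n)" for r
  proof -
    have "45 * n\<^sup>2 * r\<^sup>2 - 36 * n\<^sup>2 * r - 9 * n\<^sup>2 - 1 = 0 \<longleftrightarrow> (15 * n * r - 6 * n)\<^sup>2 = s\<^sup>2"
      unfolding s2 by (simp add: power2_eq_square algebra_simps) linarith
    also have "\<dots> \<longleftrightarrow> 15 * n * r - 6 * n = s \<or> 15 * n * r - 6 * n = - s"
      by (rule power2_eq_iff)
    also have "\<dots> \<longleftrightarrow> r = (6 * n + s) / (15 * n) \<or> r = (6 * n - s) / (15 * n)"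
      using n by (auto simp: field_simps)
    finally show ?thesis .
  qed
  have multiple: "\<exists>r. w\<^sup>2 = of_real r * B"
    if eq: "of_real (1 / 9 + (cmod (w\<^sup>2 - B))\<^sup>2) = 6 * cnj (w\<^sup>2) * (w\<^sup>2 - B)"
  proof -
    have "w\<^sup>2 * cnj (w\<^sup>2) = of_real ((cmod (w\<^sup>2))\<^sup>2)"
      by (simp only: complex_norm_square)
    then have "B * cnj (w\<^sup>2) = of_real ((cmod (w\<^sup>2))\<^sup>2 - (1 / 9 + (cmod (w\<^sup>2 - B))\<^sup>2) / 6)"
      by (simp only: of_real_diff of_real_divide eq)
        (simp add: right_diff_distrib diff_divide_distrib mult.commute)
    then obtain p where p: "B * cnj (w\<^sup>2) = of_real p"
      by blast
    then have "cnj B * w\<^sup>2 = of_real p"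
      by (metis complex_cnj_cnj complex_cnj_complex_of_real complex_cnj_mult)
    then have "of_real (n\<^sup>2) * w\<^sup>2 = of_real p * B"
      by (simp only: BB[symmetric] mult.assoc) (simp add: mult.commute)
    then have "w\<^sup>2 = of_real (p / n\<^sup>2) * B"
      using n by (simp add: field_simps)
    then show ?thesis ..
  qed
  have "of_real (1 / 9 + (cmod (w\<^sup>2 - B))\<^sup>2) = 6 * cnj (w\<^sup>2) * (w\<^sup>2 - B) \<longleftrightarrow>
    w\<^sup>2 = of_real ((6 * n + s) / (15 * n)) * B \<or> w\<^sup>2 = of_real ((6 * n - s) / (15 * n)) * B"
    (is "?eq \<longleftrightarrow> ?root")
  proof
    assume ?eq
    with multiple obtain r where "w\<^sup>2 = of_real r * B"
      by blast
    with \<open>?eq\<close> real_multiple roots show ?root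
      by metis
  next
    assume ?root
    then obtain r where r: "w\<^sup>2 = of_real r * B"
        "r = (6 * n + s) / (15 * n) \<or> r = (6 * n - s) / (15 * n)"
      by blast
    show ?eq
      unfolding real_multiple[OF r(1)] roots by (rule r(2))
  qed
  then show ?thesis
    by (simp only: n_def complex_cnj_power)
qed

text \<open>The two values of \<open>w\<^sup>2\<close> are distinct and nonzero because \<open>\<surd>(81 \<bar>B\<bar>\<^sup>2 + 5) > 6 \<bar>B\<bar>\<close>.
  Hence any square roots \<open>U\<close> and \<open>V\<close> of the two give all the critical points other than the
  barycenter.\<close>

lemma other_critical_points_from_square_roots:
  fixes a b c U V :: complex
  defines "p \<equiv> barycenter a b c" and "B \<equiv> B_triangle a b c"
  defines "s \<equiv> sqrt (81 * (cmod B)\<^sup>2 + 5)"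
  defines "S \<equiv> {z. critical_point (gaussian_curvature (\<lambda>z. (z, (z - a) * (z - b) * (z - c)))) z
    \<and> z \<noteq> p}"
  assumes "B \<noteq> 0"
    and roots: "{U\<^sup>2, V\<^sup>2} = {of_real ((6 * cmod B + s) / (15 * cmod B)) * B,
      of_real ((6 * cmod B - s) / (15 * cmod B)) * B}"
  shows "S = {p + U, p - U, p + V, p - V} \<and> card S = 4"
proof -
  let ?u = "of_real ((6 * cmod B + s) / (15 * cmod B)) * B"
  let ?v = "of_real ((6 * cmod B - s) / (15 * cmod B)) * B"
  have n: "cmod B > 0"
    using \<open>B \<noteq> 0\<close> by simp
  have s: "6 * cmod B < s"
    unfolding s_def by (rule real_less_rsqrt) (simp add: power_mult_distrib add_nonneg_pos)
  have "(6 * cmod B + s) / (15 * cmod B) \<noteq> 0" "(6 * cmod B - s) / (15 * cmod B) \<noteq> 0"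
    "(6 * cmod B + s) / (15 * cmod B) \<noteq> (6 * cmod B - s) / (15 * cmod B)"
  proof -
    have "6 * cmod B + s \<noteq> 0" "6 * cmod B - s \<noteq> 0" "s \<noteq> 0"
      using s n by linarith+
    with n show "(6 * cmod B + s) / (15 * cmod B) \<noteq> 0" "(6 * cmod B - s) / (15 * cmod B) \<noteq> 0"
      "(6 * cmod B + s) / (15 * cmod B) \<noteq> (6 * cmod B - s) / (15 * cmod B)"
      by (simp_all only: divide_eq_0_iff divide_cancel_right) auto
  qed
  then have "?u \<noteq> 0" "?v \<noteq> 0" "?u \<noteq> ?v"
    using \<open>B \<noteq> 0\<close> by (simp_all only: mult_eq_0_iff of_real_eq_0_iff mult_cancel_right
        of_real_eq_iff simp_thms)
  with roots have UV: "U\<^sup>2 \<noteq> 0" "V\<^sup>2 \<noteq> 0" "U\<^sup>2 \<noteq> V\<^sup>2"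
    by (auto simp: doubleton_eq_iff)
  have "z \<in> S \<longleftrightarrow> (z - p)\<^sup>2 \<in> {U\<^sup>2, V\<^sup>2}" for z
  proof (cases "z = p")
    case True
    then show ?thesis
      using UV by (auto simp: S_def)
  next
    case False
    then have "z \<in> S \<longleftrightarrow> (z - p)\<^sup>2 \<in> {?u, ?v}"
      using critical_point_cubic_curvature_reduced[of z a b c]
        reduced_critical_equation_iff_square[OF \<open>B \<noteq> 0\<close>, of "z - p"]
      by (simp add: S_def p_def B_def s_def)
    then show ?thesis
      by (simp only: roots)
  qed
  moreover have "(z - p)\<^sup>2 = w\<^sup>2 \<longleftrightarrow> z = p + w \<or> z = p - w" for z w
    unfolding power2_eq_iff diff_eq_eq by (simp add: add.commute)
  ultimately have S: "S = {p + U, p - U, p + V, p - V}"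
    by blast
  have "U \<noteq> - U" "V \<noteq> - V" "U \<noteq> V" "U \<noteq> - V" "- U \<noteq> V" "- U \<noteq> - V"
    using UV by auto
  then have "distinct [p + U, p - U, p + V, p - V]"
    unfolding diff_conv_add_uminus by simp
  from distinct_card[OF this] have "card (set [p + U, p - U, p + V, p - V]) = 4"
    by simp
  then have "card S = 4"
    unfolding S by simp
  with S show ?thesis
    by blast
qed

section \<open>Explicit square roots\<close>

text \<open>For \<open>d = \<plusminus>\<bar>B\<bar>\<close> the vector \<open>(B\<^sub>2, d - B\<^sub>1)\<close> spans the line that bisects the angle from
  the positive real axis to \<open>\<plusminus>B\<close>: its square is the real multiple \<open>2 (d - B\<^sub>1) B\<close> of \<open>B\<close>.
  The sign \<open>d < 0\<close> is allowed so that the statement covers both pairs of critical points; the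
  radicand \<open>d\<^sup>2 - B\<^sub>1 d\<close> is positive in either case.\<close>

lemma square_bisector:
  fixes B1 B2 d k :: real
  assumes "d\<^sup>2 = B1\<^sup>2 + B2\<^sup>2" "B2 \<noteq> 0" "k \<ge> 0"
  defines "x \<equiv> sqrt k / sqrt (d\<^sup>2 - B1 * d)"
  shows "(Complex (B2 / sqrt 30 * x) ((- B1 + d) / sqrt 30 * x))\<^sup>2
    = of_real (k / (15 * d)) * Complex B1 B2"
proof -
  have d: "\<bar>B1\<bar> < \<bar>d\<bar>"
  proof -
    have "B1\<^sup>2 < d\<^sup>2"
      using assms(1,2) by simp
    then show ?thesis
      by (simp add: power2_less_imp_less)
  qed
  have pos: "0 < d\<^sup>2 - B1 * d"
  proof -
    have "B1 * d \<le> \<bar>B1\<bar> * \<bar>d\<bar>"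
      by (simp add: abs_mult[symmetric])
    also have "\<dots> < \<bar>d\<bar> * \<bar>d\<bar>"
      using d by (intro mult_strict_right_mono) auto
    finally show ?thesis
      by (simp add: power2_eq_square)
  qed
  have d0: "d \<noteq> 0" "d - B1 \<noteq> 0"
    using d by auto
  have x2: "x\<^sup>2 / 30 * (2 * (d - B1)) = k / (15 * d)"
    using pos d0 \<open>k \<ge> 0\<close> by (simp add: x_def power_divide divide_simps)
      (simp add: power2_eq_square algebra_simps)
  have "Complex (B2 / sqrt 30 * x) ((- B1 + d) / sqrt 30 * x)
      = of_real (x / sqrt 30) * Complex B2 (d - B1)"
    by (simp add: complex_eq_iff)
  also have "\<dots>\<^sup>2 = of_real (x\<^sup>2 / 30) * (Complex B2 (d - B1))\<^sup>2"
    by (simp add: power_mult_distrib power_divide flip: of_real_power)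
  also have "(Complex B2 (d - B1))\<^sup>2 = of_real (2 * (d - B1)) * Complex B1 B2"
    using assms(1) by (simp add: complex_eq_iff power2_eq_square algebra_simps)
  finally show ?thesis
    by (simp only: mult.assoc[symmetric] of_real_mult[symmetric] x2[unfolded mult.assoc[symmetric]])
qed

section \<open>The critical points\<close>

theorem theorem3p1:
  fixes a b c :: complex and B1 B2 :: real
  assumes "\<not> collinear {a, b, c}"
    and "B_triangle a b c = Complex B1 B2"
  shows
    "let f = (\<lambda>z. (z - a) * (z - b) * (z - c));
         K = gaussian_curvature (\<lambda>z. (z, f z));
         bt = barycenter a b c;
         nB = cmod (B_triangle a b c);
         others = {z. critical_point K z \<and> z \<noteq> bt};
         X = Complex (1 / sqrt 15 * sqrt (sqrt (81 * B1\<^sup>2 + 5) + 6 * B1)) 0;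
         Y = Complex 0 (1 / sqrt 15 * sqrt (sqrt (81 * B1\<^sup>2 + 5) - 6 * B1));
         x0 = sqrt (sqrt (81 * nB\<^sup>2 + 5) + 6 * nB) / sqrt (nB\<^sup>2 - B1 * nB);
         x0' = sqrt (sqrt (81 * nB\<^sup>2 + 5) - 6 * nB) / sqrt (nB\<^sup>2 + B1 * nB);
         Z = Complex (B2 / sqrt 30 * x0) ((- B1 + nB) / sqrt 30 * x0);
         W = Complex (B2 / sqrt 30 * x0') ((- B1 - nB) / sqrt 30 * x0')
     in critical_point K bt \<and>
        (B1 = 0 \<and> B2 = 0 \<longrightarrow> others = sphere bt (1 / root 4 45)) \<and>
        (B1 \<noteq> 0 \<and> B2 = 0 \<longrightarrow>
           others = {bt + X, bt - X, bt + Y, bt - Y} \<and> card others = 4) \<and>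
        (B2 \<noteq> 0 \<longrightarrow>
           others = {bt + Z, bt - Z, bt + W, bt - W} \<and> card others = 4)"
proof -
  let ?K = "gaussian_curvature (\<lambda>z. (z, (z - a) * (z - b) * (z - c)))"
  let ?p = "barycenter a b c"
  let ?B = "B_triangle a b c"
  let ?S = "{z. critical_point ?K z \<and> z \<noteq> ?p}"
  let ?n = "cmod ?B"
  let ?s = "sqrt (81 * ?n\<^sup>2 + 5)"
  let ?u = "of_real ((6 * ?n + ?s) / (15 * ?n)) * ?B"
  let ?v = "of_real ((6 * ?n - ?s) / (15 * ?n)) * ?B"
  have B: "?B = Complex B1 B2"
    by (rule assms)
  have n2: "?n\<^sup>2 = B1\<^sup>2 + B2\<^sup>2"
    by (simp add: B cmod_power2)
  have radicands: "6 * \<bar>t\<bar> \<le> sqrt (81 * t\<^sup>2 + 5)" for t :: real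
    by (rule real_le_rsqrt) (simp add: power_mult_distrib)
  have bary: "critical_point ?K ?p"
    by (simp add: critical_point_cubic_curvature)
  have case1: "?S = sphere ?p (1 / root 4 45)"
    if "B1 = 0 \<and> B2 = 0"
  proof (rule set_eqI)
    fix z
    have B0: "?B = 0"
      using that B by (simp add: complex_eq_iff)
    have "z \<noteq> ?p" if "cmod (z - ?p) = 1 / root 4 45"
      using that by auto
    then show "z \<in> ?S \<longleftrightarrow> z \<in> sphere ?p (1 / root 4 45)"
      using critical_point_cubic_curvature_reduced[of z a b c]
        reduced_critical_equation_iff_norm[of "z - ?p"]
      by (auto simp: B0 dist_norm norm_minus_commute)
  qed
  let ?X = "Complex (1 / sqrt 15 * sqrt (sqrt (81 * B1\<^sup>2 + 5) + 6 * B1)) 0"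
  let ?Y = "Complex 0 (1 / sqrt 15 * sqrt (sqrt (81 * B1\<^sup>2 + 5) - 6 * B1))"
  have case2: "?S = {?p + ?X, ?p - ?X, ?p + ?Y, ?p - ?Y} \<and> card ?S = 4"
    if real: "B1 \<noteq> 0 \<and> B2 = 0"
  proof -
    let ?t = "sqrt (81 * B1\<^sup>2 + 5)"
    have n: "?n = \<bar>B1\<bar>"
      using real by (simp add: B cmod_def)
    have X: "?X\<^sup>2 = of_real ((6 * B1 + ?t) / 15)"
      using radicands[of B1] by (simp add: complex_eq_iff power2_eq_square field_simps)
    have Y: "?Y\<^sup>2 = of_real ((6 * B1 - ?t) / 15)"
      using radicands[of B1] by (simp add: complex_eq_iff power2_eq_square field_simps)
    have B': "?B = of_real B1"
      using real by (simp add: B complex_eq_iff)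
    have u: "?u = of_real ((6 * \<bar>B1\<bar> + ?t) / (15 * \<bar>B1\<bar>) * B1)"
      unfolding n by (simp add: B')
    have v: "?v = of_real ((6 * \<bar>B1\<bar> - ?t) / (15 * \<bar>B1\<bar>) * B1)"
      unfolding n by (simp add: B')
    \<comment> \<open>Which of the two square roots is real depends on the sign of \<open>B1\<close>.\<close>
    consider "B1 > 0" | "B1 < 0"
      using real by linarith
    then have "{?X\<^sup>2, ?Y\<^sup>2} = {?u, ?v}"
    proof cases
      case 1
      then have "?X\<^sup>2 = ?u" "?Y\<^sup>2 = ?v"
        unfolding X Y u v of_real_eq_iff by (simp_all add: field_simps)
      then show ?thesis
        by simp
    next
      case 2
      then have "?X\<^sup>2 = ?v" "?Y\<^sup>2 = ?u"
        unfolding X Y u v of_real_eq_iff by (simp_all add: field_simps)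
      then show ?thesis
        by (simp add: insert_commute)
    qed
    then show ?thesis
      by (intro other_critical_points_from_square_roots) (use real B' in \<open>simp_all\<close>)
  qed
  let ?x = "sqrt (?s + 6 * ?n) / sqrt (?n\<^sup>2 - B1 * ?n)"
  let ?x' = "sqrt (?s - 6 * ?n) / sqrt (?n\<^sup>2 + B1 * ?n)"
  let ?Z = "Complex (B2 / sqrt 30 * ?x) ((- B1 + ?n) / sqrt 30 * ?x)"
  let ?W = "Complex (B2 / sqrt 30 * ?x') ((- B1 - ?n) / sqrt 30 * ?x')"
  have case3: "?S = {?p + ?Z, ?p - ?Z, ?p + ?W, ?p - ?W} \<and> card ?S = 4" if "B2 \<noteq> 0"
  proof -
    have s: "0 \<le> ?s + 6 * ?n" "0 \<le> ?s - 6 * ?n"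
      using radicands[of ?n] by simp_all
    have "?Z\<^sup>2 = of_real ((?s + 6 * ?n) / (15 * ?n)) * Complex B1 B2"
      by (rule square_bisector[OF n2 that s(1)])
    then have Z: "?Z\<^sup>2 = ?u"
      by (simp only: B add.commute)
    have "?W\<^sup>2 = of_real ((?s - 6 * ?n) / (15 * (- ?n))) * Complex B1 B2"
      using square_bisector[of "- ?n" B1 B2 "?s - 6 * ?n"] n2 that s(2) by simp
    also have "(?s - 6 * ?n) / (15 * (- ?n)) = (6 * ?n - ?s) / (15 * ?n)"
      by (simp add: minus_divide_left)
    finally have "?W\<^sup>2 = ?v"
      by (simp only: B)
    with Z have "{?Z\<^sup>2, ?W\<^sup>2} = {?u, ?v}"
      by (simp only:)
    then show ?thesis
      by (intro other_critical_points_from_square_roots) (use that B in \<open>simp add: complex_eq_iff\<close>)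
  qed
  show ?thesis
    unfolding Let_def by (rule conjI[OF bary conjI[OF impI[OF case1] conjI[OF impI[OF case2] impI[OF case3]]]])
qed

end
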